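(* Let $m<0$ and $\sigma\ge 0.5$. The difference scheme $$\frac{\exp(m\tau)y^{n+1}-y^n}\tau+(A^n-mE)\big(\sigma\exp(m\tau)y^{n+1}+(1-\sigma)y^n\big)=0,\quad n=0,\dots,N_0-1,\qquad y^0=u^0,$$ is unconditionally (for every $\tau>0$) $\varrho$-stable in $H$ with $$\varrho=\exp(-m\tau),$$ and its solution satisfies the a priori estimate $\|y^{n+1}\|\le\varrho\|y^n\|$, $n=0,\dots,N_0-1$.
   Context: $H$ is a finite-dimensional real Hilbert space of grid functions with scalar product $(\cdot,\cdot)$ and norm $\|\cdot\|$; $E$ is the identity; $\tau>0$ is the time step, $N_0\tau=T$. $A^n=C_0^n+R^n+D$, where $D=D^*>0$ is time-independent, $(C_0^n)^*=-C_0^n$, and $R^n=(R^n)^*$ with $mE\le R^n\le ME$; only the consequence $A^n\ge mE$ (i.e. $(A^ny,y)\ge m(y,y)$ for all $y\in H$) is used as the lower bound for $A^n$. $\varrho$-stability in $H$ means $\|y^{n+1}\|\le\varrho\|y^n\|$ for all $n$ with $\varrho^n\le m_1$ for a constant $m_1$ independent of $\tau$ and $n$. *)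

theory Defs
  imports "HOL-Analysis.Analysis"
begin

definition op_le :: "('a::real_inner \<Rightarrow> 'a) \<Rightarrow> ('a \<Rightarrow> 'a) \<Rightarrow> bool" where
  "op_le P Q \<longleftrightarrow> (\<forall>y. P y \<bullet> y \<le> Q y \<bullet> y)"

definition op_pos :: "('a::real_inner \<Rightarrow> 'a) \<Rightarrow> bool" where
  "op_pos P \<longleftrightarrow> (\<forall>y. y \<noteq> 0 \<longrightarrow> 0 < P y \<bullet> y)"

text \<open>A solution of the scheme on the time grid with \<open>N0\<close> steps of length \<open>\<tau>\<close>; only the values
  \<open>y 0, \<dots>, y N0\<close> are constrained.\<close>

definition scheme_solution ::
  "real \<Rightarrow> real \<Rightarrow> (nat \<Rightarrow> 'a \<Rightarrow> 'a) \<Rightarrow> real \<Rightarrow> nat \<Rightarrow> 'a \<Rightarrow> (nat \<Rightarrow> 'a::real_inner) \<Rightarrow> bool" where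
  "scheme_solution m \<sigma> A \<tau> N0 u0 y \<longleftrightarrow>
     y 0 = u0 \<and>
     (\<forall>n<N0.
        (exp (m * \<tau>) *\<^sub>R y (Suc n) - y n) /\<^sub>R \<tau>
        + (\<lambda>x. A n x - m *\<^sub>R x)
            ((\<sigma> * exp (m * \<tau>)) *\<^sub>R y (Suc n) + (1 - \<sigma>) *\<^sub>R y n) = 0)"

text \<open>A scheme is given by the predicate \<open>S \<tau> N0 u0 y\<close>: \<open>y\<close> solves it with time step \<open>\<tau>\<close>,
  \<open>N0\<close> steps and initial value \<open>u0\<close>. The step bound is required for every \<open>\<tau> > 0\<close> with
  \<open>N0 \<tau> = T\<close> (unconditional stability), and the constant \<open>m1\<close> is chosen before \<open>\<tau>\<close>, \<open>N0\<close>
  and \<open>n\<close>.\<close>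

definition unconditionally_rho_stable ::
  "real \<Rightarrow> (real \<Rightarrow> nat \<Rightarrow> 'a \<Rightarrow> (nat \<Rightarrow> 'a::real_inner) \<Rightarrow> bool) \<Rightarrow> (real \<Rightarrow> real) \<Rightarrow> bool" where
  "unconditionally_rho_stable T S \<rho> \<longleftrightarrow>
     (\<exists>m1. \<forall>\<tau> N0. \<tau> > 0 \<and> real N0 * \<tau> = T \<longrightarrow>
        (\<forall>n\<le>N0. \<rho> \<tau> ^ n \<le> m1) \<and>
        (\<forall>u0 y. S \<tau> N0 u0 y \<longrightarrow>
           (\<forall>n<N0. norm (y (Suc n)) \<le> \<rho> \<tau> * norm (y n))))"

end

theory Submission
  imports Defs
begin

text \<open>Put \<open>z = exp (m * \<tau>) *\<^sub>R y (Suc n)\<close> and \<open>v = y n\<close>. The scheme reads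
  \<open>z - v = - \<tau> *\<^sub>R B w\<close> with \<open>B = A - m E \<ge> 0\<close> and \<open>w = (z + v) / 2 + (\<sigma> - 1/2) (z - v)\<close>;
  taking the inner product with \<open>w\<close> gives
  \<open>norm z ^ 2 - norm v ^ 2 \<le> - (2 * \<sigma> - 1) * norm (z - v) ^ 2 \<le> 0\<close>.\<close>

text \<open>Moving \<open>f\<close> across the inner product changes its sign, so
  \<open>f x \<bullet> x\<close> equals its own negative. This removes the skew part
  \<open>C0\<close> from the quadratic form of \<open>A\<close>.\<close>

lemma skew_adjoint_inner_self:
  fixes f :: "'a::euclidean_space \<Rightarrow> 'a"
  assumes "linear f" and "adjoint f = (\<lambda>x. - f x)"
  shows "f x \<bullet> x = 0"
  using adjoint_works[OF assms(1), of x x] assms(2) by (simp add: inner_commute)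

lemma weighted_step_contractive:
  fixes B :: "'a::real_inner \<Rightarrow> 'a" and z v :: 'a
  assumes "\<sigma> \<ge> 1 / 2" and "\<tau> > 0" and B: "\<And>x. 0 \<le> B x \<bullet> x"
    and eq: "(z - v) /\<^sub>R \<tau> + B (\<sigma> *\<^sub>R z + (1 - \<sigma>) *\<^sub>R v) = 0"
  shows "norm z \<le> norm v"
proof -
  let ?w = "\<sigma> *\<^sub>R z + (1 - \<sigma>) *\<^sub>R v"
  have "(z - v) /\<^sub>R \<tau> = - B ?w"
    using eq by (simp add: eq_neg_iff_add_eq_0)
  then have "((z - v) /\<^sub>R \<tau>) \<bullet> ?w \<le> 0"
    using B[of ?w] by simp
  then have "(z - v) \<bullet> ?w \<le> 0"
    using \<open>\<tau> > 0\<close> by (simp add: mult_le_0_iff)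
  \<comment> \<open>The left side is \<open>(z - v) \<bullet> (z + v)\<close>, and
    \<open>z + v\<close> is twice the weighted mean minus \<open>(2 * \<sigma> - 1)\<close> times
    \<open>z - v\<close>. The bound \<open>\<sigma> \<ge> 1 / 2\<close> makes the subtracted square
    term nonnegative.\<close>
  moreover have "z \<bullet> z - v \<bullet> v = 2 * ((z - v) \<bullet> ?w) - (2 * \<sigma> - 1) * ((z - v) \<bullet> (z - v))"
    by (simp add: inner_simps inner_commute algebra_simps)
  moreover have "0 \<le> (2 * \<sigma> - 1) * ((z - v) \<bullet> (z - v))"
    using assms(1) by simp
  ultimately show ?thesis
    by (simp add: norm_le)
qed

text \<open>The factor \<open>exp (m * \<tau>)\<close> is absorbed into the new value, so the
  contraction applies with \<open>A n\<close> shifted by \<open>m\<close>; dividing the factor out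
  again leaves \<open>exp (- m * \<tau>)\<close>.\<close>

lemma scheme_solution_step:
  assumes "\<sigma> \<ge> 1 / 2" and "\<tau> > 0" and "n < N0"
    and sol: "scheme_solution m \<sigma> A \<tau> N0 u0 y"
    and A: "op_le (\<lambda>x. m *\<^sub>R x) (A n)"
  shows "norm (y (Suc n)) \<le> exp (- m * \<tau>) * norm (y n)"
proof -
  have "norm (exp (m * \<tau>) *\<^sub>R y (Suc n)) \<le> norm (y n)"
  proof (rule weighted_step_contractive[OF assms(1,2)])
    show "0 \<le> (A n x - m *\<^sub>R x) \<bullet> x" for x
      using A by (simp add: op_le_def inner_diff_left)
    show "(exp (m * \<tau>) *\<^sub>R y (Suc n) - y n) /\<^sub>R \<tau>
        + (A n (\<sigma> *\<^sub>R exp (m * \<tau>) *\<^sub>R y (Suc n) + (1 - \<sigma>) *\<^sub>R y n)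
           - m *\<^sub>R (\<sigma> *\<^sub>R exp (m * \<tau>) *\<^sub>R y (Suc n) + (1 - \<sigma>) *\<^sub>R y n)) = 0"
      using sol \<open>n < N0\<close> by (simp add: scheme_solution_def)
  qed
  then show ?thesis
    by (simp add: exp_minus field_simps)
qed

theorem theorem22:
  fixes m M \<sigma> T :: real
    and D :: "'a::euclidean_space \<Rightarrow> 'a"
    and C0 R A :: "real \<Rightarrow> nat \<Rightarrow> 'a \<Rightarrow> 'a"
  assumes "m < 0" and "\<sigma> \<ge> 0.5"
    and "linear D" and "adjoint D = D" and "op_pos D"
    and "\<And>\<tau> N0 n. \<lbrakk>\<tau> > 0; real N0 * \<tau> = T; n < N0\<rbrakk> \<Longrightarrow>
           linear (C0 \<tau> n) \<and> adjoint (C0 \<tau> n) = (\<lambda>x. - C0 \<tau> n x)"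
    and "\<And>\<tau> N0 n. \<lbrakk>\<tau> > 0; real N0 * \<tau> = T; n < N0\<rbrakk> \<Longrightarrow>
           linear (R \<tau> n) \<and> adjoint (R \<tau> n) = R \<tau> n \<and>
           op_le (\<lambda>x. m *\<^sub>R x) (R \<tau> n) \<and> op_le (R \<tau> n) (\<lambda>x. M *\<^sub>R x)"
    and "\<And>\<tau> N0 n. \<lbrakk>\<tau> > 0; real N0 * \<tau> = T; n < N0\<rbrakk> \<Longrightarrow>
           A \<tau> n = (\<lambda>x. C0 \<tau> n x + R \<tau> n x + D x)"
  shows "unconditionally_rho_stable T (\<lambda>\<tau>. scheme_solution m \<sigma> (A \<tau>) \<tau>) (\<lambda>\<tau>. exp (- m * \<tau>)) \<and>
         (\<forall>\<tau> N0 u0 y. \<tau> > 0 \<and> real N0 * \<tau> = T \<and> scheme_solution m \<sigma> (A \<tau>) \<tau> N0 u0 y \<longrightarrow>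
            (\<forall>n<N0. norm (y (Suc n)) \<le> exp (- m * \<tau>) * norm (y n)))"
proof -
  have step: "norm (y (Suc n)) \<le> exp (- m * \<tau>) * norm (y n)"
    if "\<tau> > 0" "real N0 * \<tau> = T" "n < N0" "scheme_solution m \<sigma> (A \<tau>) \<tau> N0 u0 y"
    for \<tau> N0 u0 y n
  proof (rule scheme_solution_step[OF _ that(1,3,4)])
    show "\<sigma> \<ge> 1 / 2"
      using assms(2) by simp
    have "C0 \<tau> n x \<bullet> x = 0" for x
      using assms(6)[OF that(1-3)] by (blast intro: skew_adjoint_inner_self)
    moreover have "(m *\<^sub>R x) \<bullet> x \<le> R \<tau> n x \<bullet> x" for x
      using assms(7)[OF that(1-3)] unfolding op_le_def by blast
    \<comment> \<open>\<open>op_pos\<close> says nothing at 0, where the inner product vanishes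
      anyway.\<close>
    moreover have "0 \<le> D x \<bullet> x" for x
      using assms(5) unfolding op_pos_def by (cases "x = 0") (auto intro: less_imp_le)
    ultimately show "op_le (\<lambda>x. m *\<^sub>R x) (A \<tau> n)"
      unfolding op_le_def assms(8)[OF that(1-3)] inner_add_left
      by (smt (verit))
  qed
  \<comment> \<open>The right side serves as the constant \<open>m1\<close>: since
    \<open>n * \<tau> \<le> N0 * \<tau> = T\<close> and \<open>- m > 0\<close>, the accumulated
    exponent is at most \<open>- m * T\<close>, whatever \<tau>, \<open>N0\<close> and
    \<open>n\<close> are.\<close>
  have pow: "exp (- m * \<tau>) ^ n \<le> exp (- m * T)"
    if "\<tau> > 0" "real N0 * \<tau> = T" "n \<le> N0" for \<tau> N0 n
  proof -
    have "real n * \<tau> \<le> T"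
      using that mult_right_mono[of "real n" "real N0" \<tau>] by simp
    then have "real n * (- m * \<tau>) \<le> - m * T"
      using assms(1) mult_left_mono[of "real n * \<tau>" T "- m"] by (simp add: ac_simps)
    then show ?thesis
      by (simp only: exp_of_nat_mult[symmetric] exp_le_cancel_iff)
  qed
  show ?thesis
    unfolding unconditionally_rho_stable_def
    by (intro conjI exI[of _ "exp (- m * T)"] allI impI; elim conjE; rule pow step; assumption)
qed

end
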